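(* If a compact measured length space $(X,d,\nu)$ has nonnegative $N$-Ricci curvature for some $N\in[1,\infty)$, then for all $x\in\mathrm{supp}(\nu)$ and all $0<r_1\le r_2$, $$\nu(B_{r_2}(x))\le\left(\frac{r_2}{r_1}\right)^N\nu(B_{r_1}(x)).$$
   Context: $B_r(x)$ is the open ball of radius $r$ around $x$. A compact measured length space $(X,d,\nu)$ is a compact length space $(X,d)$ (the distance is the infimum of lengths of joining curves) with a Borel probability measure $\nu$. $P_2(X)$ is the set of Borel probability measures on $X$ with the quadratic Wasserstein metric $W_2(\mu_0,\mu_1)^2=\inf_\pi\int d(x_0,x_1)^2\,d\pi$ ($\pi$ ranging over couplings of $\mu_0,\mu_1$). A Wasserstein geodesic $\{\mu_t\}_{t\in[0,1]}$ is a minimizing geodesic of $P_2(X)$, parametrized so that $W_2(\mu_t,\mu_s)=|t-s|W_2(\mu_0,\mu_1)$. For a continuous convex $U:[0,\infty)\to\mathbb{R}$ with $U(0)=0$, put $U'(\infty)=\lim_{r\to\infty}U(r)/r$ and $U_\nu(\mu)=\int_X U(\rho)\,d\nu+U'(\infty)\mu_s(X)\in\mathbb{R}\cup\{\infty\}$, where $\mu=\rho\nu+\mu_s$ is the Lebesgue decomposition of $\mu$ with respect to $\nu$ (convention $\infty\cdot0=0$). $\mathcal{DC}_N$ ($N\in[1,\infty)$) is the set of such $U$ for which $\lambda\mapsto\lambda^N U(\lambda^{-N})$ is convex on $(0,\infty)$. $(X,d,\nu)$ has nonnegative $N$-Ricci curvature if for all $\mu_0,\mu_1\in P_2(X)$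 with supports contained in $\mathrm{supp}(\nu)$ there is some Wasserstein geodesic $\{\mu_t\}$ from $\mu_0$ to $\mu_1$ such that for all $U\in\mathcal{DC}_N$ and all $t\in[0,1]$: $U_\nu(\mu_t)\le tU_\nu(\mu_1)+(1-t)U_\nu(\mu_0)$. *)

theory Defs
  imports "HOL-Probability.Probability"
begin

section \<open>Compact measured length spaces\<close>

definition curve_length :: "(real \<Rightarrow> 'a::metric_space) \<Rightarrow> ennreal" where
  "curve_length \<gamma> =
     (SUP (n, t) \<in> {(n::nat, t::nat \<Rightarrow> real). mono_on {..n} t \<and> t 0 = 0 \<and> t n = 1}.
        \<Sum>i<n. ennreal (dist (\<gamma> (t i)) (\<gamma> (t (Suc i)))))"

text \<open>If no curve joins two points, the infimum is infinite, so a length space is path-connected.\<close>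

definition length_space :: "'a::metric_space itself \<Rightarrow> bool" where
  "length_space (_ :: 'a itself) \<longleftrightarrow>
     (\<forall>x y :: 'a. ennreal (dist x y) =
        (INF \<gamma> \<in> {\<gamma>. path \<gamma> \<and> pathstart \<gamma> = x \<and> pathfinish \<gamma> = y}. curve_length \<gamma>))"

text \<open>The set underlying \<open>P\<^sub>2(X)\<close>. On a compact space every Borel probability measure has
  finite second moment, so no moment condition is imposed.\<close>

definition borel_prob_measures :: "'a::metric_space measure set" where
  "borel_prob_measures = {\<mu>. sets \<mu> = sets borel \<and> prob_space \<mu>}"

text \<open>The space itself is the type \<open>'a\<close> with its metric \<^const>\<open>dist\<close>.\<close>

definition compact_measured_length_space :: "'a::metric_space measure \<Rightarrow> bool" where
  "compact_measured_length_space \<nu> \<longleftrightarrow>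
     compact (UNIV :: 'a set) \<and> length_space TYPE('a) \<and> \<nu> \<in> borel_prob_measures"

definition measure_support :: "'a::topological_space measure \<Rightarrow> 'a set" where
  "measure_support \<mu> = {x. \<forall>V. open V \<and> x \<in> V \<longrightarrow> emeasure \<mu> V > 0}"

section \<open>Quadratic Wasserstein distance\<close>

definition couplings ::
    "'a::metric_space measure \<Rightarrow> 'a measure \<Rightarrow> ('a \<times> 'a) measure set" where
  "couplings \<mu>\<^sub>0 \<mu>\<^sub>1 =
     {\<pi> \<in> borel_prob_measures. distr \<pi> borel fst = \<mu>\<^sub>0 \<and> distr \<pi> borel snd = \<mu>\<^sub>1}"

text \<open>The integral is a Bochner integral, which is the intended value only for integrable
  \<open>d\<^sup>2\<close>; on a compact space \<open>d\<close> is bounded, so this always holds.\<close>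

definition W2 :: "'a::metric_space measure \<Rightarrow> 'a measure \<Rightarrow> real" where
  "W2 \<mu>\<^sub>0 \<mu>\<^sub>1 = sqrt (INF \<pi> \<in> couplings \<mu>\<^sub>0 \<mu>\<^sub>1. \<integral>p. (dist (fst p) (snd p))\<^sup>2 \<partial>\<pi>)"

definition wasserstein_geodesic ::
    "(real \<Rightarrow> 'a::metric_space measure) \<Rightarrow> 'a measure \<Rightarrow> 'a measure \<Rightarrow> bool" where
  "wasserstein_geodesic \<mu> \<mu>\<^sub>0 \<mu>\<^sub>1 \<longleftrightarrow>
     (\<forall>t\<in>{0..1}. \<mu> t \<in> borel_prob_measures) \<and> \<mu> 0 = \<mu>\<^sub>0 \<and> \<mu> 1 = \<mu>\<^sub>1 \<and>
     (\<forall>s\<in>{0..1}. \<forall>t\<in>{0..1}. W2 (\<mu> t) (\<mu> s) = \<bar>t - s\<bar> * W2 \<mu>\<^sub>0 \<mu>\<^sub>1)"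

section \<open>The functionals\<close>

definition lebesgue_decomposition ::
    "'a::metric_space measure \<Rightarrow> 'a measure \<Rightarrow> ('a \<Rightarrow> real) \<Rightarrow> 'a measure \<Rightarrow> bool" where
  "lebesgue_decomposition \<nu> \<mu> \<rho> \<mu>\<^sub>s \<longleftrightarrow>
     \<rho> \<in> borel_measurable borel \<and> (\<forall>x. 0 \<le> \<rho> x) \<and>
     sets \<mu>\<^sub>s = sets borel \<and> finite_measure \<mu>\<^sub>s \<and>
     (\<exists>A\<in>sets borel. emeasure \<nu> A = 0 \<and> emeasure \<mu>\<^sub>s (- A) = 0) \<and>
     (\<forall>B\<in>sets borel. emeasure \<mu> B = emeasure (density \<nu> (\<lambda>x. ennreal (\<rho> x))) B + emeasure \<mu>\<^sub>s B)"

text \<open>Integral with values in the extended reals, as positive part minus negative part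
  (\<^const>\<open>ennreal\<close> maps negative reals to \<open>0\<close>). Below, the negative part always has finite
  integral, since a convex \<open>U\<close> with \<open>U 0 = 0\<close> is bounded below by an affine function.\<close>

definition ereal_integral :: "'a measure \<Rightarrow> ('a \<Rightarrow> real) \<Rightarrow> ereal" where
  "ereal_integral M f =
     enn2ereal (\<integral>\<^sup>+x. ennreal (f x) \<partial>M) - enn2ereal (\<integral>\<^sup>+x. ennreal (- f x) \<partial>M)"

definition U_prime_infinity :: "(real \<Rightarrow> real) \<Rightarrow> ereal" where
  "U_prime_infinity U = Lim at_top (\<lambda>r. ereal (U r / r))"

text \<open>The decomposition is unique (\<open>\<rho>\<close> up to \<open>\<nu>\<close>-null sets), so the choice is immaterial.
  In \<^typ>\<open>ereal\<close>, \<open>\<infinity> * 0 = 0\<close>.\<close>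

definition U_functional ::
    "'a::metric_space measure \<Rightarrow> (real \<Rightarrow> real) \<Rightarrow> 'a measure \<Rightarrow> ereal" where
  "U_functional \<nu> U \<mu> =
     (let (\<rho>, \<mu>\<^sub>s) = (SOME (\<rho>, \<mu>\<^sub>s). lebesgue_decomposition \<nu> \<mu> \<rho> \<mu>\<^sub>s)
      in ereal_integral \<nu> (\<lambda>x. U (\<rho> x)) + U_prime_infinity U * ereal (measure \<mu>\<^sub>s UNIV))"

text \<open>Functions on \<open>[0, \<infinity>)\<close> are represented by functions on the reals whose values at
  negative arguments are irrelevant.\<close>

definition DC :: "real \<Rightarrow> (real \<Rightarrow> real) set" where
  "DC N = {U. continuous_on {0..} U \<and> convex_on {0..} U \<and> U 0 = 0 \<and>
              convex_on {0<..} (\<lambda>l. l powr N * U (l powr (- N)))}"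

section \<open>Nonnegative N-Ricci curvature\<close>

definition nonneg_Ricci :: "real \<Rightarrow> 'a::metric_space measure \<Rightarrow> bool" where
  "nonneg_Ricci N \<nu> \<longleftrightarrow>
     (\<forall>\<mu>\<^sub>0 \<in> borel_prob_measures. \<forall>\<mu>\<^sub>1 \<in> borel_prob_measures.
        measure_support \<mu>\<^sub>0 \<subseteq> measure_support \<nu> \<longrightarrow> measure_support \<mu>\<^sub>1 \<subseteq> measure_support \<nu> \<longrightarrow>
        (\<exists>\<mu>. wasserstein_geodesic \<mu> \<mu>\<^sub>0 \<mu>\<^sub>1 \<and>
          (\<forall>U \<in> DC N. \<forall>t \<in> {0..1}.
             U_functional \<nu> U (\<mu> t) \<le>
               ereal t * U_functional \<nu> U \<mu>\<^sub>1 + ereal (1 - t) * U_functional \<nu> U \<mu>\<^sub>0)))"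

end

theory Submission
  imports Defs
begin

text \<open>
  Join the point mass at \<open>x\<close> to the uniform distribution on \<open>B\<^bsub>R\<^esub>(x)\<close>. At time \<open>t\<close> the
  geodesic lives on the closed ball of radius \<open>t R\<close>: the distance from \<open>x\<close> must be \<open>t\<close> times its
  final value by the equality case of Minkowski's inequality. For \<open>U r = - r powr (1 - 1 / M)\<close>
  with \<open>M > N\<close>, the functional is nonpositive at the point mass, equals
  \<open>- \<nu>(B\<^bsub>R\<^esub>(x)) powr (1 / M)\<close> at the uniform distribution, and by Jensen's inequality is at least
  \<open>- \<nu>(B) powr (1 / M)\<close> for measures living on \<open>B\<close>. Convexity along the geodesic therefore gives
  \<open>t \<nu>(B\<^bsub>R\<^esub>(x)) powr (1 / M) \<le> \<nu>(B\<^bsub>r\<^esub>(x)) powr (1 / M)\<close> whenever \<open>t R < r\<close>; let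
  \<open>t\<close> tend to \<open>r / R\<close> and \<open>M\<close> to \<open>N\<close>.
\<close>

section \<open>Lebesgue decomposition\<close>

text \<open>\<open>U_functional\<close> takes its decomposition from \<open>SOME\<close>, so
  existence is what gives the choice its meaning. Let \<open>L\<close> be the sum of
  \<open>\<mu>\<close> and \<open>\<nu>\<close>, and \<open>f\<close> the density of
  \<open>\<nu>\<close> with respect to \<open>L\<close>. The zero set of \<open>f\<close> carries
  the singular part; off it, \<open>\<nu>\<close>-null sets are \<open>L\<close>-null, hence
  \<open>\<mu>\<close>-null.\<close>

lemma lebesgue_decomposition_exists:
  fixes \<nu> \<mu> :: "'a::metric_space measure"
  assumes \<nu>: "sets \<nu> = sets borel" "finite_measure \<nu>"
    and \<mu>: "sets \<mu> = sets borel" "finite_measure \<mu>"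
  shows "\<exists>\<rho> \<mu>\<^sub>s. lebesgue_decomposition \<nu> \<mu> \<rho> \<mu>\<^sub>s"
proof -
  interpret \<nu>: finite_measure \<nu> by fact
  interpret \<mu>: finite_measure \<mu> by fact
  have sp: "space \<nu> = UNIV" "space \<mu> = UNIV"
    using sets_eq_imp_space_eq[OF \<nu>(1)] sets_eq_imp_space_eq[OF \<mu>(1)] by auto
  define L :: "'a measure" where
    "L = measure_of UNIV (sets borel) (\<lambda>E. emeasure \<mu> E + emeasure \<nu> E)"
  have sL: "sets L = sets borel"
    unfolding L_def using sets.sets_measure_of_eq[of "borel :: 'a measure"] by simp
  have spL: "space L = UNIV"
    by (simp add: L_def)
  have eL: "emeasure L E = emeasure \<mu> E + emeasure \<nu> E" if "E \<in> sets borel" for E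
    unfolding L_def
  proof (rule emeasure_measure_of_sigma)
    show "sigma_algebra UNIV (sets (borel :: 'a measure))"
      using sets.sigma_algebra_axioms[of "borel :: 'a measure"] by simp
    show "positive (sets borel) (\<lambda>E. emeasure \<mu> E + emeasure \<nu> E)"
      by (simp add: positive_def)
    show "countably_additive (sets borel) (\<lambda>E. emeasure \<mu> E + emeasure \<nu> E)"
    proof (rule countably_additiveI)
      fix F :: "nat \<Rightarrow> 'a set"
      assume F: "range F \<subseteq> sets borel" "disjoint_family F"
      show "(\<Sum>i. emeasure \<mu> (F i) + emeasure \<nu> (F i)) =
          emeasure \<mu> (\<Union> (range F)) + emeasure \<nu> (\<Union> (range F))"
        using F \<mu>(1) \<nu>(1) by (simp add: suminf_add[symmetric] suminf_emeasure)
    qed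
  qed fact
  interpret L: finite_measure L
    by standard (simp add: spL eL \<mu>.emeasure_finite \<nu>.emeasure_finite)
  have "absolutely_continuous L \<nu>"
    unfolding absolutely_continuous_def null_sets_def using \<nu>(1) sL by (auto simp: eL)
  then obtain f where f[measurable]: "f \<in> borel_measurable L" and df: "density L f = \<nu>"
    using L.Radon_Nikodym[of \<nu>] \<nu>(1) sL by auto
  define A where "A = {x. f x = 0}"
  have A[measurable]: "A \<in> sets borel"
  proof -
    have "{x \<in> space L. f x = 0} \<in> sets L" by measurable
    then show ?thesis by (simp add: A_def spL sL)
  qed
  have nuA: "emeasure \<nu> A = 0"
  proof -
    have "emeasure \<nu> A = (\<integral>\<^sup>+x. f x * indicator A x \<partial>L)"
      unfolding df[symmetric] using A sL by (subst emeasure_density) auto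
    also have "\<dots> = (\<integral>\<^sup>+x. 0 \<partial>L)"
      by (rule nn_integral_cong) (auto simp: A_def split: split_indicator)
    finally show ?thesis by simp
  qed
  define K where "K = density \<mu> (indicator (-A))"
  define S where "S = density \<mu> (indicator A)"
  have eK: "emeasure K E = emeasure \<mu> (- A \<inter> E)" and eS: "emeasure S E = emeasure \<mu> (A \<inter> E)"
    if "E \<in> sets borel" for E
    using that A \<mu>(1) by (auto simp: K_def S_def emeasure_restricted)
  have fin: "finite_measure K" "finite_measure S"
    by (standard; simp add: eK eS \<mu>.emeasure_finite K_def S_def sp emeasure_restricted A \<mu>(1))+
  have sK: "sets K = sets \<nu>" using \<nu>(1) \<mu>(1) by (simp add: K_def)
  have ac: "absolutely_continuous \<nu> K"
    unfolding absolutely_continuous_def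
  proof
    fix E assume "E \<in> null_sets \<nu>"
    then have E: "E \<in> sets borel" "emeasure \<nu> E = 0" using \<nu>(1) by (auto simp: null_sets_def)
    have "E \<in> null_sets (density L f)" using E df sL by (auto simp: null_sets_def)
    then have "AE x in L. x \<in> E \<longrightarrow> f x = 0"
      by (subst (asm) null_sets_density_iff) auto
    then have "AE x in L. x \<notin> - A \<inter> E" by eventually_elim (auto simp: A_def)
    then have "emeasure L (- A \<inter> E) = 0"
      using E A sL spL by (subst (asm) AE_iff_measurable[where N="- A \<inter> E"]) auto
    then have "emeasure \<mu> (- A \<inter> E) = 0" using E A by (simp add: eL)
    then show "E \<in> null_sets K" using E \<mu>(1) by (auto simp: null_sets_def eK) (simp add: K_def)
  qed
  interpret K: finite_measure K by fact
  \<comment> \<open>\<open>lebesgue_decomposition\<close> asks for a density with nonnegative real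
    values everywhere, whereas \<open>RN_deriv\<close> takes values in \<open>ennreal\<close>; hence
    a real representative.\<close>
  obtain D where D: "D \<in> borel_measurable \<nu>" "AE x in \<nu>. RN_deriv \<nu> K x = ennreal (D x)"
      "\<And>x. 0 \<le> D x"
    using \<nu>.real_RN_deriv[OF fin(1) ac] sK by metis
  have "density \<nu> (\<lambda>x. ennreal (D x)) = density \<nu> (RN_deriv \<nu> K)"
    using D by (intro density_cong) auto
  also have "\<dots> = K"
    using \<nu>.density_RN_deriv[OF ac] \<nu>(1) \<mu>(1) by (auto simp: K_def)
  finally have dK: "density \<nu> (\<lambda>x. ennreal (D x)) = K" .
  have "lebesgue_decomposition \<nu> \<mu> D S"
    unfolding lebesgue_decomposition_def
  proof (intro conjI)
    show "D \<in> borel_measurable borel" using D(1) \<nu>(1) by (simp cong: measurable_cong_sets)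
    show "sets S = sets borel" using \<mu>(1) by (simp add: S_def)
    show "\<exists>A\<in>sets borel. emeasure \<nu> A = 0 \<and> emeasure S (- A) = 0"
      using A nuA by (intro bexI[of _ A]) (auto simp: eS)
    show "\<forall>B\<in>sets borel. emeasure \<mu> B = emeasure (density \<nu> (\<lambda>x. ennreal (D x))) B + emeasure S B"
    proof
      fix B :: "'a set" assume B: "B \<in> sets borel"
      have "emeasure \<mu> ((- A \<inter> B) \<union> (A \<inter> B)) = emeasure \<mu> (- A \<inter> B) + emeasure \<mu> (A \<inter> B)"
        using A B \<mu>(1) by (subst plus_emeasure) auto
      moreover have "(- A \<inter> B) \<union> (A \<inter> B) = B" by auto
      ultimately show "emeasure \<mu> B = emeasure (density \<nu> (\<lambda>x. ennreal (D x))) B + emeasure S B"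
        using B by (simp add: dK eK eS)
    qed
  qed (use D fin in auto)
  then show ?thesis by blast
qed

section \<open>The power entropy\<close>

text \<open>The right-hand side is the tangent at \<open>z\<close> of a concave power. After scaling
  by \<open>z\<close> it is Young's inequality for \<open>x / z\<close> and \<open>1\<close> with
  weights \<open>q\<close> and \<open>1 - q\<close>. It serves both for the convexity of the entropy
  and for Jensen's inequality.\<close>

lemma powr_tangent_le:
  fixes x z q :: real
  assumes "0 \<le> x" "0 < z" "0 < q" "q \<le> 1"
  shows "x powr q \<le> z powr q * (q * (x / z) + (1 - q))"
proof -
  have "(x / z) powr q \<le> q * (x / z) + (1 - q)"
  proof (cases "x = 0")
    case False
    then have "(x / z) powr q * 1 powr (1 - q) \<le> q * (x / z) + (1 - q) * 1"
      using assms by (intro Youngs_inequality_0) auto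
    then show ?thesis by simp
  qed (use assms in auto)
  then have "z powr q * (x / z) powr q \<le> z powr q * (q * (x / z) + (1 - q))"
    by (intro mult_left_mono) auto
  then show ?thesis using assms by (simp add: powr_divide)
qed

text \<open>Average the tangent bounds taken at the convex combination \<open>z\<close> of the two
  points.\<close>

lemma convex_on_minus_powr:
  fixes q :: real
  assumes "0 < q" "q \<le> 1"
  shows "convex_on {0..} (\<lambda>x. - (x powr q))"
  unfolding convex_on_def
proof (intro conjI ballI allI impI)
  show "convex {0::real..}" by simp
  fix x y u v :: real
  assume xy: "x \<in> {0..}" "y \<in> {0..}" and uv: "0 \<le> u" "0 \<le> v" "u + v = 1"
  define z where "z = u * x + v * y"
  have z0: "0 \<le> z" using xy uv by (auto simp: z_def)
  have "u * x powr q + v * y powr q \<le> z powr q"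
  \<comment> \<open>The tangent bound requires \<open>z > 0\<close>. If \<open>z = 0\<close>, each
    of the two points has weight zero or is itself \<open>0\<close>, where the power
    vanishes.\<close>
  proof (cases "z = 0")
    case True
    then have "u * x = 0" "v * y = 0"
      using xy uv by (auto simp: z_def add_nonneg_eq_0_iff)
    then show ?thesis using assms True by auto
  next
    case False
    then have z: "0 < z" using z0 by simp
    have "u * x powr q + v * y powr q \<le> u * (z powr q * (q * (x / z) + (1 - q)))
        + v * (z powr q * (q * (y / z) + (1 - q)))"
      using powr_tangent_le[of _ z q] xy uv z assms by (intro add_mono mult_left_mono) auto
    also have "\<dots> = z powr q * (q * ((u * x + v * y) / z) + (u + v) * (1 - q))"
      by (simp add: algebra_simps add_divide_distrib)
    also have "\<dots> = z powr q" using z uv by (simp add: z_def[symmetric])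
    finally show ?thesis .
  qed
  then show "- ((u *\<^sub>R x + v *\<^sub>R y) powr q) \<le> u * - (x powr q) + v * - (y powr q)"
    by (simp add: z_def)
qed

text \<open>The substitution in \<open>DC\<close> produces minus the power \<open>N / M\<close>,
  convex because \<open>N / M < 1\<close>. Strictness of \<open>N < M\<close> keeps the exponent
  \<open>1 - 1 / M\<close> positive even for \<open>N = 1\<close>, which gives continuity at
  \<open>0\<close>.\<close>

lemma minus_powr_in_DC:
  fixes M N :: real
  assumes "1 \<le> N" "N < M"
  shows "(\<lambda>r. - (r powr (1 - 1 / M))) \<in> DC N"
proof -
  have p: "0 < 1 - 1 / M" "1 - 1 / M \<le> 1" using assms by (auto simp: field_simps)
  have "convex_on {0<..} (\<lambda>l::real. - (l powr (N / M)))"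
    using assms by (intro convex_on_subset[OF convex_on_minus_powr]) auto
  moreover have "l powr N * - ((l powr - N) powr (1 - 1 / M)) = - (l powr (N / M))" if "l > 0" for l
  proof -
    have "l powr N * (l powr - N) powr (1 - 1 / M) = l powr (N + (- N) * (1 - 1 / M))"
      using that by (simp add: powr_powr powr_add[symmetric])
    also have "N + (- N) * (1 - 1 / M) = N / M" by (simp add: algebra_simps)
    finally show ?thesis by simp
  qed
  ultimately have "convex_on {0<..} (\<lambda>l. l powr N * - ((l powr - N) powr (1 - 1 / M)))"
    by (auto simp: convex_on_def convex_def)
  moreover have "continuous_on {0..} (\<lambda>r::real. - (r powr (1 - 1 / M)))"
    using p by (intro continuous_intros continuous_on_powr') auto
  ultimately show ?thesis using convex_on_minus_powr[OF p] by (simp add: DC_def)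
qed

text \<open>Sublinear growth; it makes singular parts invisible to the power entropy.\<close>

lemma U_prime_infinity_minus_powr:
  fixes p :: real
  assumes "p < 1"
  shows "U_prime_infinity (\<lambda>r. - (r powr p)) = 0"
  unfolding U_prime_infinity_def
proof (rule tendsto_Lim)
  have "((\<lambda>r::real. - (r powr (p - 1))) \<longlongrightarrow> - 0) at_top"
    using assms by (intro tendsto_minus tendsto_neg_powr filterlim_ident) auto
  then have "((\<lambda>r::real. ereal (- (r powr (p - 1)))) \<longlongrightarrow> ereal 0) at_top" by simp
  then have "((\<lambda>r::real. ereal (- (r powr p) / r)) \<longlongrightarrow> ereal 0) at_top"
    by (rule filterlim_cong[THEN iffD1, rotated -1])
      (auto intro!: eventually_mono[OF eventually_gt_at_top[of 0]] simp: powr_diff)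
  then show "((\<lambda>r::real. ereal (- (r powr p) / r)) \<longlongrightarrow> 0) at_top"
    by (simp add: zero_ereal_def)
qed simp

text \<open>The singular term vanishes and the integrand is nonpositive, so minus one nonnegative
  integral remains. The pair obtained is the one picked by \<open>SOME\<close>; the estimates below
  work from its property \<open>lebesgue_decomposition\<close>.\<close>

lemma U_functional_minus_powr:
  fixes \<nu> \<mu> :: "'a::metric_space measure"
  assumes "\<nu> \<in> borel_prob_measures" "\<mu> \<in> borel_prob_measures" "p < 1"
  obtains \<rho> \<mu>\<^sub>s where "lebesgue_decomposition \<nu> \<mu> \<rho> \<mu>\<^sub>s"
    "U_functional \<nu> (\<lambda>r. - (r powr p)) \<mu> = - enn2ereal (\<integral>\<^sup>+x. ennreal (\<rho> x powr p) \<partial>\<nu>)"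
proof -
  obtain \<rho> \<mu>\<^sub>s where eq: "(SOME (\<rho>, \<mu>\<^sub>s). lebesgue_decomposition \<nu> \<mu> \<rho> \<mu>\<^sub>s) = (\<rho>, \<mu>\<^sub>s)"
    by fastforce
  have "\<exists>\<rho> \<mu>\<^sub>s. lebesgue_decomposition \<nu> \<mu> \<rho> \<mu>\<^sub>s"
    using assms
    by (intro lebesgue_decomposition_exists) (auto simp: borel_prob_measures_def prob_space_def)
  then have "case (SOME (\<rho>, \<mu>\<^sub>s). lebesgue_decomposition \<nu> \<mu> \<rho> \<mu>\<^sub>s) of
      (\<rho>, \<mu>\<^sub>s) \<Rightarrow> lebesgue_decomposition \<nu> \<mu> \<rho> \<mu>\<^sub>s"
    by (intro someI_ex[of "\<lambda>(\<rho>, \<mu>\<^sub>s). lebesgue_decomposition \<nu> \<mu> \<rho> \<mu>\<^sub>s"]) auto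
  then have "lebesgue_decomposition \<nu> \<mu> \<rho> \<mu>\<^sub>s" by (simp add: eq)
  moreover have "U_functional \<nu> (\<lambda>r. - (r powr p)) \<mu> = - enn2ereal (\<integral>\<^sup>+x. ennreal (\<rho> x powr p) \<partial>\<nu>)"
    using assms(3)
    by (simp add: U_functional_def eq U_prime_infinity_minus_powr ereal_integral_def ennreal_neg
        zero_ennreal.rep_eq)
  ultimately show thesis by (rule that)
qed

text \<open>Meant for the starting point mass, which is singular or not depending on whether its
  point is an atom of \<open>\<nu>\<close>; the sign covers both cases.\<close>

lemma U_functional_minus_powr_nonpos:
  fixes \<nu> \<mu> :: "'a::metric_space measure"
  assumes "\<nu> \<in> borel_prob_measures" "\<mu> \<in> borel_prob_measures" "p < 1"
  shows "U_functional \<nu> (\<lambda>r. - (r powr p)) \<mu> \<le> 0"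
  by (rule U_functional_minus_powr[OF assms]) (auto simp: enn2ereal_nonneg)

text \<open>The density is \<open>1 / m\<close> on \<open>B\<close>, where \<open>m\<close> is the
  measure of \<open>B\<close>, so the entropy is minus \<open>m * (1 / m) powr p\<close>. The work
  lies in showing that the decomposition picked by \<open>SOME\<close> has this density.\<close>

lemma U_functional_uniform_measure_le:
  fixes \<nu> :: "'a::metric_space measure"
  assumes \<nu>: "\<nu> \<in> borel_prob_measures" and B[measurable]: "B \<in> sets borel"
    and pos: "0 < measure \<nu> B" and p: "p < 1"
  shows "U_functional \<nu> (\<lambda>r. - (r powr p)) (uniform_measure \<nu> B)
    \<le> ereal (- (measure \<nu> B powr (1 - p)))"
proof -
  have s\<nu>[measurable_cong]: "sets \<nu> = sets borel" and "prob_space \<nu>"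
    using \<nu> by (auto simp: borel_prob_measures_def)
  interpret prob_space \<nu> by fact
  define m where "m = measure \<nu> B"
  have eB: "emeasure \<nu> B = ennreal m" by (simp add: m_def emeasure_eq_measure)
  have m: "0 < m" using pos by (simp add: m_def)
  let ?\<mu> = "uniform_measure \<nu> B"
  have P: "prob_space ?\<mu>"
    using m eB by (intro prob_space_uniform_measure) auto
  have "?\<mu> \<in> borel_prob_measures" using P s\<nu> by (simp add: borel_prob_measures_def)
  from U_functional_minus_powr[OF \<nu> this p] obtain \<rho> S
    where L: "lebesgue_decomposition \<nu> ?\<mu> \<rho> S"
      and U: "U_functional \<nu> (\<lambda>r. - (r powr p)) ?\<mu> = - enn2ereal (\<integral>\<^sup>+x. ennreal (\<rho> x powr p) \<partial>\<nu>)" .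
  obtain A where A: "A \<in> sets borel" "emeasure \<nu> A = 0" "emeasure S (- A) = 0"
    using L by (auto simp: lebesgue_decomposition_def)
  have [measurable]: "\<rho> \<in> borel_measurable borel" and \<rho>0: "\<And>x. 0 \<le> \<rho> x"
    and sS: "sets S = sets borel"
    and dec: "\<And>E. E \<in> sets borel \<Longrightarrow>
      emeasure ?\<mu> E = emeasure (density \<nu> (\<lambda>x. ennreal (\<rho> x))) E + emeasure S E"
    using L by (auto simp: lebesgue_decomposition_def)
  \<comment> \<open>The singular part \<open>S\<close> lives on the \<open>\<nu>\<close>-null set
    \<open>A\<close>, where the uniform measure vanishes too; hence \<open>S\<close> is
    zero.\<close>
  have "emeasure \<nu> (B \<inter> A) = 0"
    using A B s\<nu> by (metis Int_lower2 emeasure_mono le_zero_eq)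
  then have "emeasure ?\<mu> A = 0" using A B s\<nu> by simp
  then have "emeasure S A = 0" using dec[OF A(1)] by simp
  then have S0: "emeasure S E = 0" if "E \<in> sets borel" for E
  proof -
    have "emeasure S E \<le> emeasure S (A \<union> - A)"
      using A sS by (intro emeasure_mono) auto
    also have "\<dots> \<le> emeasure S A + emeasure S (- A)"
      using A sS by (intro emeasure_subadditive) auto
    finally show ?thesis using A \<open>emeasure S A = 0\<close> by simp
  qed
  have "density \<nu> (\<lambda>x. ennreal (\<rho> x)) = ?\<mu>"
    by (rule measure_eqI) (use dec S0 s\<nu> in auto)
  also have "\<dots> = density \<nu> (\<lambda>x. indicator B x / emeasure \<nu> B)"
    by (simp add: uniform_measure_def)
  finally have eq: "density \<nu> (\<lambda>x. ennreal (\<rho> x)) = density \<nu> (\<lambda>x. indicator B x / emeasure \<nu> B)" .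
  have "AE x in \<nu>. ennreal (\<rho> x) = indicator B x / emeasure \<nu> B"
  proof (rule sigma_finite_density_unique[THEN iffD1, OF _ _ _ eq])
    show "sigma_finite_measure (density \<nu> (\<lambda>x. ennreal (\<rho> x)))"
      using P \<open>density \<nu> (\<lambda>x. ennreal (\<rho> x)) = ?\<mu>\<close>
      by (simp add: prob_space_def finite_measure_def)
  qed measurable
  then have "AE x in \<nu>. ennreal (m powr - p) * indicator B x = ennreal (\<rho> x powr p)"
  proof eventually_elim
    case (elim x)
    show ?case
    proof (cases "x \<in> B")
      case True
      then have "ennreal (\<rho> x) = ennreal (1 / m)"
        using elim eB m by (simp add: divide_ennreal flip: ennreal_1)
      then have "\<rho> x = 1 / m" using \<rho>0 m by (simp add: ennreal_inj)
      then show ?thesis using True m by (simp add: powr_divide powr_minus_divide)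
    \<comment> \<open>Off \<open>B\<close> the density is zero, and \<open>0 powr p = 0\<close> for
      every \<open>p\<close>, including \<open>p \<le> 0\<close>.\<close>
    qed (use elim \<rho>0[of x] in \<open>auto simp: ennreal_eq_0_iff\<close>)
  qed
  then have "(\<integral>\<^sup>+x. ennreal (\<rho> x powr p) \<partial>\<nu>) = (\<integral>\<^sup>+x. ennreal (m powr - p) * indicator B x \<partial>\<nu>)"
    by (intro nn_integral_cong_AE) auto
  also have "\<dots> = ennreal (m powr - p) * ennreal m"
    using B s\<nu> by (subst nn_integral_cmult_indicator) (auto simp: eB)
  also have "\<dots> = ennreal (m powr (1 - p))"
    using m by (simp add: ennreal_mult[symmetric] powr_diff powr_minus_divide)
  finally show ?thesis using U by (simp add: m_def)
qed

text \<open>Among measures living on \<open>B\<close>, spreading the mass evenly makes the integral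
  of \<open>\<rho> powr p\<close> largest, since the power is concave. A singular part only lowers
  the mass of \<open>\<rho>\<close> below \<open>1\<close>.\<close>

lemma U_functional_minus_powr_ge:
  fixes \<nu> \<mu> :: "'a::metric_space measure"
  assumes \<nu>: "\<nu> \<in> borel_prob_measures" and \<mu>: "\<mu> \<in> borel_prob_measures"
    and B[measurable]: "B \<in> sets borel" and pos: "0 < measure \<nu> B"
    and conc: "emeasure \<mu> (- B) = 0" and p: "0 < p" "p < 1"
  shows "ereal (- (measure \<nu> B powr (1 - p))) \<le> U_functional \<nu> (\<lambda>r. - (r powr p)) \<mu>"
proof -
  have s\<nu>[measurable_cong]: "sets \<nu> = sets borel" and "prob_space \<nu>"
    and s\<mu>: "sets \<mu> = sets borel" and "prob_space \<mu>"
    using \<nu> \<mu> by (auto simp: borel_prob_measures_def)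
  interpret prob_space \<nu> by fact
  have e1: "emeasure \<mu> UNIV = 1"
    using prob_space.emeasure_space_1[OF \<open>prob_space \<mu>\<close>] sets_eq_imp_space_eq[OF s\<mu>] by simp
  define m where "m = measure \<nu> B"
  have eB: "emeasure \<nu> B = ennreal m" by (simp add: m_def emeasure_eq_measure)
  have m: "0 < m" using pos by (simp add: m_def)
  obtain \<rho> S where L: "lebesgue_decomposition \<nu> \<mu> \<rho> S"
      and U: "U_functional \<nu> (\<lambda>r. - (r powr p)) \<mu> = - enn2ereal (\<integral>\<^sup>+x. ennreal (\<rho> x powr p) \<partial>\<nu>)"
    using U_functional_minus_powr[OF \<nu> \<mu> p(2)] .
  have [measurable]: "\<rho> \<in> borel_measurable borel" and \<rho>0: "\<And>x. 0 \<le> \<rho> x"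
    and dec: "\<And>E. E \<in> sets borel \<Longrightarrow>
      emeasure \<mu> E = emeasure (density \<nu> (\<lambda>x. ennreal (\<rho> x))) E + emeasure S E"
    using L by (auto simp: lebesgue_decomposition_def)
  have le: "(\<integral>\<^sup>+x. ennreal (\<rho> x) * indicator E x \<partial>\<nu>) \<le> emeasure \<mu> E" if E: "E \<in> sets borel" for E
    using dec[OF E] E s\<nu> by (simp add: emeasure_density)
  have "(\<integral>\<^sup>+x. ennreal (\<rho> x) * indicator (- B) x \<partial>\<nu>) = 0"
    using le[of "- B"] conc by simp
  then have "AE x in \<nu>. ennreal (\<rho> x) * indicator (- B) x = 0"
    by (subst (asm) nn_integral_0_iff_AE) auto
  then have off: "AE x in \<nu>. x \<notin> B \<longrightarrow> \<rho> x = 0"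
    by eventually_elim (use \<rho>0 in \<open>auto simp: ennreal_eq_0_iff order_antisym split: split_indicator_asm\<close>)
  have tot: "(\<integral>\<^sup>+x. ennreal (\<rho> x) \<partial>\<nu>) \<le> 1" using le[of UNIV] e1 by simp
  \<comment> \<open>The value of the power at \<open>1 / m\<close>; the tangent there has slope
    \<open>c * p * m\<close> and intercept \<open>c * (1 - p)\<close>.\<close>
  define c where "c = m powr - p"
  have c: "0 \<le> c" by (simp add: c_def)
  text \<open>Jensen's inequality: bound \<open>\<rho> powr p\<close> by its tangent at the mean value \<open>1 / m\<close> on \<open>B\<close>.\<close>
  have "(\<integral>\<^sup>+x. ennreal (\<rho> x powr p) \<partial>\<nu>)
      \<le> (\<integral>\<^sup>+x. ennreal (c * p * m) * ennreal (\<rho> x) + ennreal (c * (1 - p)) * indicator B x \<partial>\<nu>)"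
  proof (rule nn_integral_mono_AE, use off in eventually_elim)
    case (elim x)
    show "ennreal (\<rho> x powr p)
        \<le> ennreal (c * p * m) * ennreal (\<rho> x) + ennreal (c * (1 - p)) * indicator B x"
    proof (cases "x \<in> B")
      case True
      have "\<rho> x powr p \<le> (1 / m) powr p * (p * (\<rho> x / (1 / m)) + (1 - p))"
        using \<rho>0 m p by (intro powr_tangent_le) auto
      also have "\<dots> = c * p * m * \<rho> x + c * (1 - p)"
        using m by (simp add: c_def powr_divide powr_minus_divide field_simps)
      finally have "ennreal (\<rho> x powr p) \<le> ennreal (c * p * m * \<rho> x + c * (1 - p))"
        by (rule ennreal_leI)
      then show ?thesis
        using True c p m \<rho>0[of x] by (simp add: ennreal_mult[symmetric] ennreal_plus[symmetric] del: ennreal_plus)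
    qed (use elim in auto)
  qed
  also have "\<dots> = ennreal (c * p * m) * (\<integral>\<^sup>+x. ennreal (\<rho> x) \<partial>\<nu>) + ennreal (c * (1 - p)) * ennreal m"
    using B s\<nu> by (simp add: nn_integral_add nn_integral_cmult nn_integral_cmult_indicator eB)
  \<comment> \<open>The slope is nonnegative, so a total mass of at most \<open>1\<close> is enough
    to bound the linear term.\<close>
  also have "\<dots> \<le> ennreal (c * p * m) * 1 + ennreal (c * (1 - p)) * ennreal m"
    using tot by (intro add_mono mult_left_mono) auto
  also have "\<dots> = ennreal (c * p * m + c * (1 - p) * m)"
    using c p m by (simp add: ennreal_mult[symmetric] ennreal_plus[symmetric] del: ennreal_plus)
  also have "c * p * m + c * (1 - p) * m = c * m" by (simp add: algebra_simps)
  also have "\<dots> = m powr (1 - p)"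
    using m by (simp add: c_def powr_diff powr_minus_divide)
  finally have "enn2ereal (\<integral>\<^sup>+x. ennreal (\<rho> x powr p) \<partial>\<nu>) \<le> ereal (m powr (1 - p))"
    by (metis enn2ereal_ennreal less_eq_ennreal.rep_eq powr_ge_zero)
  then show ?thesis using U by (simp add: m_def flip: uminus_ereal.simps(1))
qed

section \<open>Wasserstein geodesics issuing from a point mass\<close>

text \<open>A compact metric space is totally bounded, so the balls of radius
  \<open>1 / Suc n\<close> about finite nets form a countable family, and every open set of the
  square is a countable union of products of them. This lets product measures act on the Borel sets
  of the square, as \<open>couplings\<close> demands.\<close>

lemma compact_open_in_pair_sets:
  fixes W :: "('a::metric_space \<times> 'a) set"
  assumes "compact (UNIV :: 'a set)" "open W"
  shows "W \<in> sets ((borel :: 'a measure) \<Otimes>\<^sub>M (borel :: 'a measure))"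
proof -
  have "\<forall>n::nat. \<exists>k::'a set. finite k \<and> UNIV \<subseteq> (\<Union>x\<in>k. ball x (1 / Suc n))"
    using assms(1) by (auto simp: compact_eq_totally_bounded)
  then obtain k :: "nat \<Rightarrow> 'a set" where
    k: "\<And>n. finite (k n)" "\<And>n. UNIV \<subseteq> (\<Union>x\<in>k n. ball x (1 / Suc n))"
    by metis
  define C where "C = (SIGMA n:UNIV. k n \<times> k n)"
  define R where "R = (\<lambda>(n, a, b). ball a (1 / Suc n) \<times> ball b (1 / Suc n) :: ('a \<times> 'a) set)"
  have C: "countable C"
    unfolding C_def using k(1) by (intro countable_SIGMA countable_SIGMA) (auto intro: countable_finite)
  have "W = (\<Union>i\<in>{i\<in>C. R i \<subseteq> W}. R i)"
  proof (intro equalityI subsetI)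
    fix w assume "w \<in> W"
    obtain x y where w: "w = (x, y)" by (cases w)
    obtain U V where UV: "open U" "open V" "x \<in> U" "y \<in> V" "U \<times> V \<subseteq> W"
      using assms(2) \<open>w \<in> W\<close> w by (auto elim!: open_prod_elim)
    obtain e1 where e1: "0 < e1" "ball x e1 \<subseteq> U" using UV openE by blast
    obtain e2 where e2: "0 < e2" "ball y e2 \<subseteq> V" using UV openE by blast
    \<comment> \<open>A net ball of radius \<open>1 / Suc n\<close> containing a point stays within
      \<open>2 / Suc n\<close> of it; hence the division by \<open>2\<close>.\<close>
    obtain n where n: "1 / real (Suc n) < min e1 e2 / 2"
      using reals_Archimedean[of "min e1 e2 / 2"] e1 e2 by (auto simp: inverse_eq_divide)
    obtain a where a: "a \<in> k n" "dist a x < 1 / Suc n" using k(2)[of n] by fastforce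
    obtain b where b: "b \<in> k n" "dist b y < 1 / Suc n" using k(2)[of n] by fastforce
    have "ball a (1 / Suc n) \<subseteq> ball x e1"
    proof
      fix z assume "z \<in> ball a (1 / Suc n)"
      then have "dist x z < e1"
        using dist_triangle[of x z a] a(2) n by (simp add: dist_commute)
      then show "z \<in> ball x e1" by simp
    qed
    moreover have "ball b (1 / Suc n) \<subseteq> ball y e2"
    proof
      fix z assume "z \<in> ball b (1 / Suc n)"
      then have "dist y z < e2"
        using dist_triangle[of y z b] b(2) n by (simp add: dist_commute)
      then show "z \<in> ball y e2" by simp
    qed
    ultimately have "R (n, a, b) \<subseteq> W" using e1 e2 UV unfolding R_def by fast
    moreover have "w \<in> R (n, a, b)" using a b w by (simp add: R_def)
    moreover have "(n, a, b) \<in> C" using a b by (simp add: C_def)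
    ultimately show "w \<in> (\<Union>i\<in>{i\<in>C. R i \<subseteq> W}. R i)" by blast
  qed auto
  moreover have "(\<Union>i\<in>{i\<in>C. R i \<subseteq> W}. R i) \<in> sets ((borel :: 'a measure) \<Otimes>\<^sub>M (borel :: 'a measure))"
    using C by (intro sets.countable_UN') (auto simp: R_def)
  ultimately show ?thesis by simp
qed

text \<open>The product measure is a coupling. Nonemptiness matters because a real infimum over the
  empty set would say nothing about costs.\<close>

lemma couplings_nonempty:
  fixes \<mu>\<^sub>0 \<mu>\<^sub>1 :: "'a::metric_space measure"
  assumes "compact (UNIV :: 'a set)" "\<mu>\<^sub>0 \<in> borel_prob_measures" "\<mu>\<^sub>1 \<in> borel_prob_measures"
  shows "couplings \<mu>\<^sub>0 \<mu>\<^sub>1 \<noteq> {}"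
proof -
  have s[measurable_cong]: "sets \<mu>\<^sub>0 = sets borel" "sets \<mu>\<^sub>1 = sets borel"
    and P: "prob_space \<mu>\<^sub>0" "prob_space \<mu>\<^sub>1"
    using assms by (auto simp: borel_prob_measures_def)
  interpret \<mu>0: prob_space \<mu>\<^sub>0 by fact
  interpret \<mu>1: prob_space \<mu>\<^sub>1 by fact
  interpret pair_prob_space \<mu>\<^sub>0 \<mu>\<^sub>1 ..
  have sp: "space \<mu>\<^sub>0 = UNIV" "space \<mu>\<^sub>1 = UNIV"
    using s[THEN sets_eq_imp_space_eq] by auto
  \<comment> \<open>Pushing forward along the identity changes only the sigma-algebra, from the
    product one to the Borel one.\<close>
  have id: "(\<lambda>z. z) \<in> measurable (\<mu>\<^sub>0 \<Otimes>\<^sub>M \<mu>\<^sub>1) borel"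
  proof (rule borel_measurableI)
    fix W :: "('a \<times> 'a) set" assume "open W"
    then have "W \<in> sets (borel \<Otimes>\<^sub>M borel)" by (rule compact_open_in_pair_sets[OF assms(1)])
    also have "sets (borel \<Otimes>\<^sub>M borel) = sets (\<mu>\<^sub>0 \<Otimes>\<^sub>M \<mu>\<^sub>1)"
      using s by (intro sets_pair_measure_cong) auto
    finally show "(\<lambda>z. z) -` W \<inter> space (\<mu>\<^sub>0 \<Otimes>\<^sub>M \<mu>\<^sub>1) \<in> sets (\<mu>\<^sub>0 \<Otimes>\<^sub>M \<mu>\<^sub>1)"
      by (simp add: space_pair_measure sp)
  qed
  let ?\<pi> = "distr (\<mu>\<^sub>0 \<Otimes>\<^sub>M \<mu>\<^sub>1) borel (\<lambda>z. z)"
  have f: "fst \<in> borel_measurable (borel :: ('a \<times> 'a) measure)"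
    "snd \<in> borel_measurable (borel :: ('a \<times> 'a) measure)"
    by (auto intro!: borel_measurable_continuous_onI continuous_intros)
  have "distr ?\<pi> borel fst = \<mu>\<^sub>0"
  proof (rule measure_eqI)
    fix E assume "E \<in> sets (distr ?\<pi> borel fst)"
    then have E: "E \<in> sets borel" by simp
    have "emeasure (distr ?\<pi> borel fst) E = emeasure (\<mu>\<^sub>0 \<Otimes>\<^sub>M \<mu>\<^sub>1) (E \<times> UNIV)"
      using E by (subst distr_distr[OF f(1) id], subst emeasure_distr)
        (auto simp: space_pair_measure sp comp_def intro!: arg_cong[where f="emeasure _"])
    also have "\<dots> = emeasure \<mu>\<^sub>0 E"
      using E s \<mu>1.emeasure_space_1 sp by (subst \<mu>1.emeasure_pair_measure_Times) auto
    finally show "emeasure (distr ?\<pi> borel fst) E = emeasure \<mu>\<^sub>0 E" .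
  qed (use s in auto)
  moreover have "distr ?\<pi> borel snd = \<mu>\<^sub>1"
  proof (rule measure_eqI)
    fix E assume "E \<in> sets (distr ?\<pi> borel snd)"
    then have E: "E \<in> sets borel" by simp
    have "emeasure (distr ?\<pi> borel snd) E = emeasure (\<mu>\<^sub>0 \<Otimes>\<^sub>M \<mu>\<^sub>1) (UNIV \<times> E)"
      using E by (subst distr_distr[OF f(2) id], subst emeasure_distr)
        (auto simp: space_pair_measure sp comp_def intro!: arg_cong[where f="emeasure _"])
    also have "\<dots> = emeasure \<mu>\<^sub>1 E"
      using E s \<mu>0.emeasure_space_1 sp by (subst \<mu>1.emeasure_pair_measure_Times) auto
    finally show "emeasure (distr ?\<pi> borel snd) E = emeasure \<mu>\<^sub>1 E" .
  qed (use s in auto)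
  moreover have "prob_space ?\<pi>" using id by (rule prob_space_distr)
  ultimately have "?\<pi> \<in> couplings \<mu>\<^sub>0 \<mu>\<^sub>1" by (simp add: couplings_def borel_prob_measures_def)
  then show ?thesis by blast
qed

text \<open>In any coupling with a point mass the first coordinate is almost surely
  \<open>x\<close>, so all couplings have the same cost and the infimum runs over a constant
  nonempty family.\<close>

lemma W2_return:
  fixes \<mu> :: "'a::metric_space measure"
  assumes cpt: "compact (UNIV :: 'a set)" and \<mu>: "\<mu> \<in> borel_prob_measures"
  shows "(W2 (return borel x) \<mu>)\<^sup>2 = (\<integral>y. (dist x y)\<^sup>2 \<partial>\<mu>)"
proof -
  have mf: "fst \<in> borel_measurable (borel :: ('a \<times> 'a) measure)"
    "snd \<in> borel_measurable (borel :: ('a \<times> 'a) measure)"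
    "(\<lambda>p. (dist (fst p) (snd p))\<^sup>2) \<in> borel_measurable (borel :: ('a \<times> 'a) measure)"
    "(\<lambda>p. (dist x (snd p))\<^sup>2) \<in> borel_measurable (borel :: ('a \<times> 'a) measure)"
    "(\<lambda>y. (dist x y)\<^sup>2) \<in> borel_measurable borel"
    by (auto intro!: borel_measurable_continuous_onI continuous_intros)
  have "(\<integral>p. (dist (fst p) (snd p))\<^sup>2 \<partial>\<pi>) = (\<integral>y. (dist x y)\<^sup>2 \<partial>\<mu>)"
    if "\<pi> \<in> couplings (return borel x) \<mu>" for \<pi>
  proof -
    have s[measurable_cong]: "sets \<pi> = sets borel" and d: "distr \<pi> borel fst = return borel x"
      "distr \<pi> borel snd = \<mu>"
      using that by (auto simp: couplings_def borel_prob_measures_def)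
    note [measurable] = mf
    have "AE y in distr \<pi> borel fst. y = x"
      unfolding d by (subst AE_return) auto
    then have "AE p in \<pi>. fst p = x"
      by (subst (asm) AE_distr_iff) auto
    then have "(\<integral>p. (dist (fst p) (snd p))\<^sup>2 \<partial>\<pi>) = (\<integral>p. (dist x (snd p))\<^sup>2 \<partial>\<pi>)"
      by (intro integral_cong_AE) auto
    also have "\<dots> = (\<integral>y. (dist x y)\<^sup>2 \<partial>(distr \<pi> borel snd))"
      by (subst integral_distr) auto
    finally show ?thesis by (simp add: d)
  qed
  moreover have "couplings (return borel x) \<mu> \<noteq> {}"
    by (rule couplings_nonempty[OF cpt _ \<mu>]) (simp add: borel_prob_measures_def prob_space_return)
  ultimately have "(INF \<pi> \<in> couplings (return borel x) \<mu>. \<integral>p. (dist (fst p) (snd p))\<^sup>2 \<partial>\<pi>)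
      = (\<integral>y. (dist x y)\<^sup>2 \<partial>\<mu>)"
    by (simp cong: INF_cong_simp)
  then show ?thesis by (simp add: W2_def)
qed

text \<open>Quantitative equality case of \<open>c\<^sup>2 \<le> (a + b)\<^sup>2 \<le> a\<^sup>2 / t + b\<^sup>2 / (1 - t)\<close>.\<close>

lemma triangle_defect:
  fixes a b c t :: real
  assumes "0 < t" "t < 1" "c \<le> a + b" "a \<le> c + b"
  shows "(a - t * c)\<^sup>2 \<le> (1 - t) * a\<^sup>2 + t * b\<^sup>2 - t * (1 - t) * c\<^sup>2"
proof -
  have "\<bar>c - a\<bar> \<le> \<bar>b\<bar>" using assms by auto
  then have "(c - a)\<^sup>2 \<le> b\<^sup>2" by (simp only: abs_le_square_iff)
  then have "t * (c - a)\<^sup>2 \<le> t * b\<^sup>2" using assms by (intro mult_left_mono) auto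
  then show ?thesis by (simp add: power2_eq_square algebra_simps)
qed

text \<open>Near-optimal couplings suffice, so the existence of an optimal one is not needed: the
  integrated defect is at most \<open>t\<close> times the excess cost.\<close>

lemma wasserstein_geodesic_concentrated:
  fixes \<mu> :: "real \<Rightarrow> 'a::metric_space measure"
  assumes cpt: "compact (UNIV :: 'a set)"
    and geo: "wasserstein_geodesic \<mu> (return borel x) \<mu>\<^sub>1"
    and conc: "AE y in \<mu>\<^sub>1. dist x y < R"
    and t: "0 < t" "t < 1" and r: "t * R < r"
  shows "emeasure (\<mu> t) (- ball x r) = 0"
proof -
  define W where "W = W2 (return borel x) \<mu>\<^sub>1"
  have pm: "\<mu> t \<in> borel_prob_measures" "\<mu>\<^sub>1 \<in> borel_prob_measures"
    using geo t by (auto simp: wasserstein_geodesic_def)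
  have ends: "\<mu> 0 = return borel x" "\<mu> 1 = \<mu>\<^sub>1"
    using geo unfolding wasserstein_geodesic_def by blast+
  have lin: "W2 (\<mu> s') (\<mu> s) = \<bar>s' - s\<bar> * W" if "s \<in> {0..1}" "s' \<in> {0..1}" for s s'
    using geo that unfolding wasserstein_geodesic_def W_def by blast
  have W: "W2 (return borel x) (\<mu> t) = t * W" "W2 (\<mu> t) \<mu>\<^sub>1 = (1 - t) * W"
    using lin[of t 0] lin[of 1 t] ends t by auto
  have st[measurable_cong]: "sets (\<mu> t) = sets borel" and "prob_space (\<mu> t)"
    using pm by (auto simp: borel_prob_measures_def)
  interpret T: prob_space "\<mu> t" by fact
  define E where "E = - ball x r"
  have E[measurable]: "E \<in> sets borel" by (simp add: E_def)
  \<comment> \<open>If \<open>fst p\<close> lies outside \<open>ball x r\<close> and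
    \<open>snd p\<close> within \<open>R\<close> of \<open>x\<close>, then
    \<open>dist x (fst p) - t * dist x (snd p)\<close> is at least this margin.\<close>
  define \<delta> where "\<delta> = r - t * R"
  have \<delta>: "0 < \<delta>" using r by (simp add: \<delta>_def)
  obtain D where D: "\<And>y z :: 'a. dist y z \<le> D"
    using compact_imp_bounded[OF cpt] by (auto simp: bounded_two_points)
  \<comment> \<open>The infimum is nonnegative, so squaring undoes the root in \<open>W2\<close>,
    and some coupling comes within \<open>e\<close> of it.\<close>
  have cost: "\<exists>\<pi>\<in>couplings (\<mu> t) \<mu>\<^sub>1. (\<integral>p. (dist (fst p) (snd p))\<^sup>2 \<partial>\<pi>) < ((1 - t) * W)\<^sup>2 + e"
    if "0 < e" for e
  proof -
    let ?I = "INF \<pi> \<in> couplings (\<mu> t) \<mu>\<^sub>1. \<integral>p. (dist (fst p) (snd p))\<^sup>2 \<partial>\<pi>"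
    have ne: "couplings (\<mu> t) \<mu>\<^sub>1 \<noteq> {}" by (rule couplings_nonempty[OF cpt pm])
    then have "0 \<le> ?I" by (intro cINF_greatest) auto
    then have "?I = ((1 - t) * W)\<^sup>2"
      unfolding W(2)[symmetric] W2_def by (rule real_sqrt_pow2[symmetric])
    then have "?I < ((1 - t) * W)\<^sup>2 + e" using that by simp
    from cInf_lessD[OF _ this] ne show ?thesis by blast
  qed
  \<comment> \<open>Chebyshev's argument for the defect of the triangle \<open>x\<close>,
    \<open>fst p\<close>, \<open>snd p\<close>: its integral is small, yet it is almost surely at
    least \<open>\<delta>\<^sup>2\<close> where \<open>fst p\<close> lies in
    \<open>E\<close>.\<close>
  have key: "\<delta>\<^sup>2 * measure (\<mu> t) E \<le> t * e" if e: "0 < e" for e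
  proof -
    obtain \<pi> where \<pi>: "\<pi> \<in> couplings (\<mu> t) \<mu>\<^sub>1"
      and c\<pi>: "(\<integral>p. (dist (fst p) (snd p))\<^sup>2 \<partial>\<pi>) < ((1 - t) * W)\<^sup>2 + e"
      using cost[OF e] by blast
    have s[measurable_cong]: "sets \<pi> = sets borel" and "prob_space \<pi>"
      and d: "distr \<pi> borel fst = \<mu> t" "distr \<pi> borel snd = \<mu>\<^sub>1"
      using \<pi> by (auto simp: couplings_def borel_prob_measures_def)
    interpret prob_space \<pi> by fact
    have sp: "space \<pi> = UNIV" using sets_eq_imp_space_eq[OF s] by simp
    let ?a = "\<lambda>p::'a\<times>'a. dist x (fst p)" and ?b = "\<lambda>p::'a\<times>'a. dist (fst p) (snd p)"
      and ?c = "\<lambda>p::'a\<times>'a. dist x (snd p)"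
    have mf[measurable]: "fst \<in> borel_measurable (borel :: ('a \<times> 'a) measure)"
      "snd \<in> borel_measurable (borel :: ('a \<times> 'a) measure)"
      "(\<lambda>p. (?a p)\<^sup>2) \<in> borel_measurable borel" "(\<lambda>p. (?b p)\<^sup>2) \<in> borel_measurable borel"
      "(\<lambda>p. (?c p)\<^sup>2) \<in> borel_measurable borel"
      "(\<lambda>y. (dist x y)\<^sup>2) \<in> borel_measurable borel" "(\<lambda>y. dist x y) \<in> borel_measurable borel"
      by (auto intro!: borel_measurable_continuous_onI continuous_intros)
    have sq: "(dist y z)\<^sup>2 \<le> D\<^sup>2" for y z :: 'a
      using D by (intro power_mono) auto
    have int: "integrable \<pi> (\<lambda>p. (?a p)\<^sup>2)" "integrable \<pi> (\<lambda>p. (?b p)\<^sup>2)" "integrable \<pi> (\<lambda>p. (?c p)\<^sup>2)"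
      by (rule integrable_const_bound[where B="D\<^sup>2"]; use sq in auto)+
    have Ia: "(\<integral>p. (?a p)\<^sup>2 \<partial>\<pi>) = (t * W)\<^sup>2"
    proof -
      have "(\<integral>p. (?a p)\<^sup>2 \<partial>\<pi>) = (\<integral>y. (dist x y)\<^sup>2 \<partial>(distr \<pi> borel fst))"
        by (subst integral_distr) auto
      then show ?thesis using W2_return[OF cpt pm(1), of x] by (simp add: d W)
    qed
    have Ic: "(\<integral>p. (?c p)\<^sup>2 \<partial>\<pi>) = W\<^sup>2"
    proof -
      have "(\<integral>p. (?c p)\<^sup>2 \<partial>\<pi>) = (\<integral>y. (dist x y)\<^sup>2 \<partial>(distr \<pi> borel snd))"
        by (subst integral_distr) auto
      then show ?thesis using W2_return[OF cpt pm(2), of x] by (simp add: d W_def)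
    qed
    have "AE p in \<pi>. ?c p < R"
      using conc unfolding d(2)[symmetric] by (subst (asm) AE_distr_iff) auto
    then have ae: "AE p in \<pi>. \<delta>\<^sup>2 * indicator (fst -` E) p
        \<le> (1 - t) * (?a p)\<^sup>2 + t * (?b p)\<^sup>2 - t * (1 - t) * (?c p)\<^sup>2"
    proof eventually_elim
      case (elim p)
      have tri: "(?a p - t * ?c p)\<^sup>2 \<le> (1 - t) * (?a p)\<^sup>2 + t * (?b p)\<^sup>2 - t * (1 - t) * (?c p)\<^sup>2"
        using t dist_triangle[of x "snd p" "fst p"] dist_triangle2[of x "fst p" "snd p"]
        by (intro triangle_defect) auto
      have "\<delta>\<^sup>2 * indicator (fst -` E) p \<le> (?a p - t * ?c p)\<^sup>2"
      proof (cases "fst p \<in> E")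
        case True
        have "t * ?c p \<le> t * R" using elim t by (intro mult_left_mono) auto
        then have "\<delta> \<le> ?a p - t * ?c p" using True by (simp add: E_def \<delta>_def)
        then have "\<delta>\<^sup>2 \<le> (?a p - t * ?c p)\<^sup>2" using \<delta> by (intro power_mono) auto
        then show ?thesis using True by simp
      qed simp
      then show ?case using tri by linarith
    qed
    have mE[measurable]: "fst -` E \<in> sets \<pi>"
      using measurable_sets[OF mf(1) E] s by simp
    have "\<delta>\<^sup>2 * measure (\<mu> t) E = \<delta>\<^sup>2 * measure \<pi> (fst -` E)"
      unfolding d(1)[symmetric] by (subst measure_distr) (auto simp: sp)
    also have "\<dots> = (\<integral>p. \<delta>\<^sup>2 * indicator (fst -` E) p \<partial>\<pi>)" by (simp add: sp)
    also have "\<dots> \<le> (\<integral>p. (1 - t) * (?a p)\<^sup>2 + t * (?b p)\<^sup>2 - t * (1 - t) * (?c p)\<^sup>2 \<partial>\<pi>)"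
      using int mE ae
      by (intro integral_mono_AE integrable_add Bochner_Integration.integrable_diff
          integrable_mult_right integrable_real_indicator) (auto simp: emeasure_eq_measure)
    also have "\<dots> = (1 - t) * (t * W)\<^sup>2 + t * (\<integral>p. (?b p)\<^sup>2 \<partial>\<pi>) - t * (1 - t) * W\<^sup>2"
      using int by (simp add: Ia Ic)
    also have "\<dots> \<le> (1 - t) * (t * W)\<^sup>2 + t * (((1 - t) * W)\<^sup>2 + e) - t * (1 - t) * W\<^sup>2"
      using c\<pi> t by (intro diff_right_mono add_left_mono mult_left_mono) auto
    \<comment> \<open>The terms in \<open>W\<^sup>2\<close> cancel, as
      \<open>(1 - t) * t\<^sup>2 + t * (1 - t)\<^sup>2 = t * (1 - t)\<close>; here the constant
      speed of the geodesic pays off.\<close>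
    also have "\<dots> = t * e" by (simp add: power2_eq_square algebra_simps)
    finally show ?thesis .
  qed
  have "\<delta>\<^sup>2 * measure (\<mu> t) E \<le> 0"
  proof (rule field_le_epsilon)
    fix e :: real assume "0 < e"
    then show "\<delta>\<^sup>2 * measure (\<mu> t) E \<le> 0 + e" using key[of "e / t"] t by simp
  qed
  then have "measure (\<mu> t) E = 0"
    using \<delta> by (simp add: mult_le_0_iff measure_le_0_iff)
  then show ?thesis by (simp add: T.emeasure_eq_measure E_def)
qed

section \<open>Volume comparison\<close>

lemma measure_support_return:
  "measure_support (return borel x) \<subseteq> {x :: 'a::t1_space}"
proof
  fix y assume y: "y \<in> measure_support (return borel x)"
  show "y \<in> {x}"
  proof (rule ccontr)
    assume "y \<notin> {x}"
    then have "0 < emeasure (return borel x) (- {x})"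
      using y unfolding measure_support_def by (auto intro: open_Compl)
    then show False by (simp add: emeasure_return)
  qed
qed

lemma measure_support_uniform_measure:
  fixes \<nu> :: "'a::topological_space measure"
  assumes "sets \<nu> = sets borel" "B \<in> sets borel"
  shows "measure_support (uniform_measure \<nu> B) \<subseteq> measure_support \<nu>"
proof
  fix y assume y: "y \<in> measure_support (uniform_measure \<nu> B)"
  have "0 < emeasure \<nu> V" if V: "open V" "y \<in> V" for V
  proof -
    have "0 < emeasure (uniform_measure \<nu> B) V" using y V by (auto simp: measure_support_def)
    then have "emeasure \<nu> (B \<inter> V) \<noteq> 0" using assms V by auto
    moreover have "emeasure \<nu> (B \<inter> V) \<le> emeasure \<nu> V"
      using assms V by (intro emeasure_mono) auto
    ultimately show ?thesis by (auto simp: zero_less_iff_neq_zero)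
  qed
  then show "y \<in> measure_support \<nu>" by (auto simp: measure_support_def)
qed

text \<open>Entropy convexity at time \<open>t\<close> for one exponent \<open>M\<close>, with both
  sides negated. Strictness of \<open>t * R < r\<close> supplies the positive margin on which the
  concentration lemma rests.\<close>

lemma ball_measure_powr_le:
  fixes \<nu> :: "'a::metric_space measure" and M N :: real
  assumes X: "compact_measured_length_space \<nu>"
    and N: "1 \<le> N" and ricci: "nonneg_Ricci N \<nu>" and M: "N < M"
    and x: "x \<in> measure_support \<nu>"
    and t: "0 < t" "t < 1" and r: "0 < r" "0 < R" "t * R < r"
  shows "t * measure \<nu> (ball x R) powr (1 / M) \<le> measure \<nu> (ball x r) powr (1 / M)"
proof -
  have cpt: "compact (UNIV :: 'a set)" and \<nu>: "\<nu> \<in> borel_prob_measures"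
    using X by (auto simp: compact_measured_length_space_def)
  then have s\<nu>: "sets \<nu> = sets borel" and "prob_space \<nu>" by (auto simp: borel_prob_measures_def)
  interpret prob_space \<nu> by fact
  \<comment> \<open>The support condition on \<open>x\<close> makes the uniform measure on
    \<open>ball x R\<close> a probability measure and provides the positivity that both entropy
    bounds assume.\<close>
  have pos: "0 < measure \<nu> (ball x \<epsilon>)" if "0 < \<epsilon>" for \<epsilon>
  proof -
    have "0 < emeasure \<nu> (ball x \<epsilon>)" using x that by (auto simp: measure_support_def)
    then show ?thesis by (simp add: emeasure_eq_measure)
  qed
  define p where "p = 1 - 1 / M"
  define U where "U = (\<lambda>r::real. - (r powr p))"
  have p: "0 < p" "p < 1" "1 - p = 1 / M" using N M by (auto simp: p_def field_simps)
  have DC: "U \<in> DC N" using minus_powr_in_DC[OF N M] by (simp add: U_def p_def)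
  let ?\<mu>0 = "return borel x" and ?\<mu>1 = "uniform_measure \<nu> (ball x R)"
  have e0: "emeasure \<nu> (ball x R) \<noteq> 0" using pos[OF r(2)] by (simp add: emeasure_eq_measure)
  have \<mu>0: "?\<mu>0 \<in> borel_prob_measures"
    by (simp add: borel_prob_measures_def prob_space_return)
  have \<mu>1: "?\<mu>1 \<in> borel_prob_measures"
    using e0 s\<nu> by (simp add: borel_prob_measures_def prob_space_uniform_measure)
  obtain \<mu> where geo: "wasserstein_geodesic \<mu> ?\<mu>0 ?\<mu>1"
    and cv: "\<forall>U \<in> DC N. \<forall>t \<in> {0..1}. U_functional \<nu> U (\<mu> t)
      \<le> ereal t * U_functional \<nu> U ?\<mu>1 + ereal (1 - t) * U_functional \<nu> U ?\<mu>0"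
    using ricci[unfolded nonneg_Ricci_def, rule_format, OF \<mu>0 \<mu>1] measure_support_return[of x] x
      measure_support_uniform_measure[OF s\<nu>, of "ball x R"]
    by auto
  have "AE y in ?\<mu>1. y \<in> ball x R"
    using s\<nu> by (intro AE_uniform_measureI) auto
  then have conc: "AE y in ?\<mu>1. dist x y < R" by simp
  have \<mu>t: "\<mu> t \<in> borel_prob_measures" using geo t by (auto simp: wasserstein_geodesic_def)
  have "ereal (- (measure \<nu> (ball x r) powr (1 / M))) \<le> U_functional \<nu> U (\<mu> t)"
    using U_functional_minus_powr_ge[OF \<nu> \<mu>t _ pos[OF r(1)]
        wasserstein_geodesic_concentrated[OF cpt geo conc t r(3)] p(1,2)]
    by (simp add: U_def p)
  also have "\<dots> \<le> ereal t * U_functional \<nu> U ?\<mu>1 + ereal (1 - t) * U_functional \<nu> U ?\<mu>0"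
    using cv DC t by auto
  \<comment> \<open>The uniform measure contributes its full entropy, the point mass at most
    \<open>0\<close>; the weights \<open>t\<close> and \<open>1 - t\<close> are nonnegative.\<close>
  also have "\<dots> \<le> ereal t * ereal (- (measure \<nu> (ball x R) powr (1 / M))) + ereal (1 - t) * 0"
    using U_functional_uniform_measure_le[OF \<nu> _ pos[OF r(2)] p(2)]
      U_functional_minus_powr_nonpos[OF \<nu> \<mu>0 p(2)] t
    by (intro add_mono ereal_mult_left_mono) (auto simp: U_def p)
  finally show ?thesis by simp
qed

theorem theorem5p31:
  fixes \<nu> :: "'a::metric_space measure" and N :: real
  assumes "compact_measured_length_space \<nu>"
    and "1 \<le> N"
    and "nonneg_Ricci N \<nu>"
  shows "\<forall>x \<in> measure_support \<nu>. \<forall>r\<^sub>1 r\<^sub>2 :: real. 0 < r\<^sub>1 \<and> r\<^sub>1 \<le> r\<^sub>2 \<longrightarrow>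
    measure \<nu> (ball x r\<^sub>2) \<le> (r\<^sub>2 / r\<^sub>1) powr N * measure \<nu> (ball x r\<^sub>1)"
proof (intro ballI allI impI)
  fix x and r\<^sub>1 r\<^sub>2 :: real
  assume x: "x \<in> measure_support \<nu>" and "0 < r\<^sub>1 \<and> r\<^sub>1 \<le> r\<^sub>2"
  then have r: "0 < r\<^sub>1" "r\<^sub>1 \<le> r\<^sub>2" "0 < r\<^sub>2" by auto
  define V1 where "V1 = measure \<nu> (ball x r\<^sub>1)"
  define V2 where "V2 = measure \<nu> (ball x r\<^sub>2)"
  have V: "0 \<le> V1" "0 \<le> V2" by (auto simp: V1_def V2_def)
  have bound: "V2 \<le> (r\<^sub>2 / r\<^sub>1) powr M * V1" if M: "N < M" for M
  proof -
    have M0: "0 < M" using M assms(2) by simp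
    \<comment> \<open>Time \<open>r\<^sub>1 / r\<^sub>2\<close> would give \<open>t * R = r\<close>,
      so it is shrunk by a factor \<open>s < 1\<close> that may be arbitrarily close to
      \<open>1\<close>. The shrinking also keeps the time below \<open>1\<close> when both radii
      agree.\<close>
    have "r\<^sub>1 / r\<^sub>2 * V2 powr (1 / M) \<le> V1 powr (1 / M)"
    proof (rule field_le_mult_one_interval)
      fix s :: real assume s: "0 < s" "s < 1"
      have "s * (r\<^sub>1 / r\<^sub>2) < 1 * 1"
        using s r by (intro mult_less_le_imp_less) auto
      then have "s * (r\<^sub>1 / r\<^sub>2) * V2 powr (1 / M) \<le> V1 powr (1 / M)"
        unfolding V1_def V2_def using s r
        by (intro ball_measure_powr_le[OF assms M x]) auto
      then show "s * (r\<^sub>1 / r\<^sub>2 * V2 powr (1 / M)) \<le> V1 powr (1 / M)" by (simp add: mult.assoc)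
    qed
    then have "V2 powr (1 / M) \<le> r\<^sub>2 / r\<^sub>1 * V1 powr (1 / M)" using r by (simp add: field_simps)
    then have "(V2 powr (1 / M)) powr M \<le> (r\<^sub>2 / r\<^sub>1 * V1 powr (1 / M)) powr M"
      using M0 by (intro powr_mono2) auto
    moreover have "(r\<^sub>2 / r\<^sub>1 * V1 powr (1 / M)) powr M = (r\<^sub>2 / r\<^sub>1) powr M * (V1 powr (1 / M)) powr M"
      by (rule powr_mult)
    ultimately show ?thesis using M0 V by (simp add: powr_powr)
  qed
  text \<open>Letting \<open>M\<close> decrease to \<open>N\<close> covers \<open>N = 1\<close>, where the exponent \<open>1 - 1 / N\<close> degenerates.\<close>
  have "((\<lambda>M. (r\<^sub>2 / r\<^sub>1) powr M * V1) \<longlongrightarrow> (r\<^sub>2 / r\<^sub>1) powr N * V1) (at_right N)"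
    using r by (intro tendsto_intros) auto
  moreover have "\<forall>\<^sub>F M in at_right N. V2 \<le> (r\<^sub>2 / r\<^sub>1) powr M * V1"
    using bound by (auto simp: eventually_at_right_less intro: eventually_mono[OF eventually_at_right_less])
  ultimately have "V2 \<le> (r\<^sub>2 / r\<^sub>1) powr N * V1"
    by (intro tendsto_lowerbound) auto
  then show "measure \<nu> (ball x r\<^sub>2) \<le> (r\<^sub>2 / r\<^sub>1) powr N * measure \<nu> (ball x r\<^sub>1)"
    by (simp add: V1_def V2_def)
qed

end
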